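(* For every integer $n\ge 0$, as polynomials in $s,t$, $$A_n(1+s,1+t)=B_n(s,t)\quad\text{and}\quad A^{\circ}_n(1+s,1+t)=B^{\circ}_n(s,t).$$
   Context: Let $[n]=\{1,\dots,n\}$. A Cayley permutation on $[n]$ is a map $v:[n]\to[n]$ with image $[k]$ for some $k\le n$; it is identified with the word $v_1\cdots v_n$, $v_i=v(i)$. $\mathrm{Cay}[n]$ is the set of Cayley permutations on $[n]$, $\mathrm{Sym}[n]\subseteq\mathrm{Cay}[n]$ the set of permutations of $[n]$, and $\mathrm{I}[n]$ the set of weakly increasing Cayley permutations on $[n]$ (for $n=0$ each consists of the empty word only). $\max(v)$ denotes the largest letter of $v$ ($0$ for the empty word). For a word $v$ of length $n$: $D(v)=\{i\in[n-1]: v(i)\ge v(i+1)\}$, $D^{\circ}(v)=\{i\in[n-1]: v(i)>v(i+1)\}$, $\mathrm{des}(v)=|D(v)|$, and $\mathrm{asc}(v)=|\{i\in[n-1]: v(i)\le v(i+1)\}|$. $\mathrm{Bur}[n]=\{(u,v)\in\mathrm{I}[n]\times\mathrm{Cay}[n]: D(u)\subseteq D(v)\}$ and $\mathrm{Bur}^{01}[n]=\{(u,v)\in\mathrm{I}[n]\times\mathrm{Cay}[n]: D(u)\subseteq D^{\circ}(v)\}$. Two-sided Eulerian polynomials (weak and strict): $A_n(s,t)=\sum_{v\in\mathrm{Sym}[n]}s^{\mathrm{des}(v)}t^{\mathrm{des}(v^{-1})}$, $A^{\circ}_n(s,t)=\sum_{v\in\mathrm{Sym}[n]}s^{\mathrm{des}(v)}t^{\mathrm{asc}(v^{-1})}$.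 Two-sided Caylerian polynomials (weak and strict): $B_n(s,t)=\sum_{(u,v)\in\mathrm{Bur}[n]}s^{n-\max(u)}t^{n-\max(v)}$, $B^{\circ}_n(s,t)=\sum_{(u,v)\in\mathrm{Bur}^{01}[n]}s^{n-\max(u)}t^{n-\max(v)}$. *)

theory Defs
  imports Complex_Main "HOL-Library.FuncSet" "HOL-Computational_Algebra.Polynomial"
begin

section \<open>Cayley permutations\<close>

text \<open>A word of length \<open>n\<close> is a map on \<open>{1..n}\<close>, made extensional (value
  \<open>undefined\<close> outside \<open>{1..n}\<close>) so that distinct functions are distinct words.\<close>

definition Cay :: "nat \<Rightarrow> (nat \<Rightarrow> nat) set" where
  "Cay n = {v \<in> {1..n} \<rightarrow>\<^sub>E {1..n}. \<exists>k\<le>n. v ` {1..n} = {1..k}}"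

definition Sym :: "nat \<Rightarrow> (nat \<Rightarrow> nat) set" where
  "Sym n = {v \<in> Cay n. bij_betw v {1..n} {1..n}}"

definition Inc :: "nat \<Rightarrow> (nat \<Rightarrow> nat) set" where
  "Inc n = {v \<in> Cay n. mono_on {1..n} v}"

definition max_letter :: "nat \<Rightarrow> (nat \<Rightarrow> nat) \<Rightarrow> nat" where
  "max_letter n v = (if n = 0 then 0 else Max (v ` {1..n}))"

definition perm_inv :: "nat \<Rightarrow> (nat \<Rightarrow> nat) \<Rightarrow> nat \<Rightarrow> nat" where
  "perm_inv n v = restrict (inv_into {1..n} v) {1..n}"

definition weak_descents :: "nat \<Rightarrow> (nat \<Rightarrow> nat) \<Rightarrow> nat set" where
  "weak_descents n v = {i \<in> {1..<n}. v i \<ge> v (i + 1)}"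

definition strict_descents :: "nat \<Rightarrow> (nat \<Rightarrow> nat) \<Rightarrow> nat set" where
  "strict_descents n v = {i \<in> {1..<n}. v i > v (i + 1)}"

definition des :: "nat \<Rightarrow> (nat \<Rightarrow> nat) \<Rightarrow> nat" where
  "des n v = card (weak_descents n v)"

text \<open>Ascents are weak, like the descents counted by \<^const>\<open>des\<close>.\<close>

definition asc :: "nat \<Rightarrow> (nat \<Rightarrow> nat) \<Rightarrow> nat" where
  "asc n v = card {i \<in> {1..<n}. v i \<le> v (i + 1)}"

section \<open>Burge words\<close>

definition Bur :: "nat \<Rightarrow> ((nat \<Rightarrow> nat) \<times> (nat \<Rightarrow> nat)) set" where
  "Bur n = {(u, v) \<in> Inc n \<times> Cay n. weak_descents n u \<subseteq> weak_descents n v}"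

definition Bur01 :: "nat \<Rightarrow> ((nat \<Rightarrow> nat) \<times> (nat \<Rightarrow> nat)) set" where
  "Bur01 n = {(u, v) \<in> Inc n \<times> Cay n. weak_descents n u \<subseteq> strict_descents n v}"

lemma finite_Cay: "finite (Cay n)"
  unfolding Cay_def by (rule finite_subset[of _ "{1..n} \<rightarrow>\<^sub>E {1..n}"]) (auto intro: finite_PiE)

lemma finite_Sym: "finite (Sym n)"
  unfolding Sym_def using finite_Cay by simp

lemma finite_Bur: "finite (Bur n)" and finite_Bur01: "finite (Bur01 n)"
  by (rule finite_subset[of _ "Cay n \<times> Cay n"]; auto simp: Bur_def Bur01_def Inc_def finite_Cay)+

section \<open>Polynomials in two variables\<close>

text \<open>Elements of \<open>\<int>[s,t]\<close> are represented as \<open>\<int>[t][s]\<close>, of type \<^typ>\<open>int poly poly\<close>: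
  the outer variable is \<open>s\<close>, the inner one \<open>t\<close>.\<close>

definition var_s :: "int poly poly" where
  "var_s = [:0, 1:]"

definition var_t :: "int poly poly" where
  "var_t = [:[:0, 1:]:]"

text \<open>\<open>subst2 p f g\<close> is \<open>p(f, g)\<close>: simultaneous substitution of \<open>f\<close> for \<open>s\<close> and \<open>g\<close> for \<open>t\<close>.\<close>

definition subst2 :: "int poly poly \<Rightarrow> int poly poly \<Rightarrow> int poly poly \<Rightarrow> int poly poly" where
  "subst2 p f g = poly (map_poly (\<lambda>c. poly (map_poly of_int c) g) p) f"

definition two_sided_Eulerian :: "nat \<Rightarrow> int poly poly" where
  "two_sided_Eulerian n = (\<Sum>v\<in>Sym n. var_s ^ des n v * var_t ^ des n (perm_inv n v))"

definition two_sided_Eulerian_strict :: "nat \<Rightarrow> int poly poly" where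
  "two_sided_Eulerian_strict n = (\<Sum>v\<in>Sym n. var_s ^ des n v * var_t ^ asc n (perm_inv n v))"

definition two_sided_Caylerian :: "nat \<Rightarrow> int poly poly" where
  "two_sided_Caylerian n =
     (\<Sum>(u, v)\<in>Bur n. var_s ^ (n - max_letter n u) * var_t ^ (n - max_letter n v))"

definition two_sided_Caylerian_strict :: "nat \<Rightarrow> int poly poly" where
  "two_sided_Caylerian_strict n =
     (\<Sum>(u, v)\<in>Bur01 n. var_s ^ (n - max_letter n u) * var_t ^ (n - max_letter n v))"

lemma subst2_0: "subst2 0 f g = 0"
  by (simp add: subst2_def)

lemma subst2_add: "subst2 (p + q) f g = subst2 p f g + subst2 q f g"
proof -
  have a: "map_poly of_int (c + d) = (map_poly of_int c + map_poly of_int d :: int poly poly poly)"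
    for c d :: "int poly"
    by (rule poly_eqI) (simp add: coeff_map_poly)
  show ?thesis
    unfolding subst2_def poly_add[symmetric]
    by (rule arg_cong[where f = "\<lambda>p. poly p f"], rule poly_eqI) (simp add: coeff_map_poly a)
qed

lemma subst2_sum: "subst2 (sum h A) f g = (\<Sum>x\<in>A. subst2 (h x) f g)"
  by (induction A rule: infinite_finite_induct) (simp_all add: subst2_0 subst2_add)

lemma var_monom: "var_s ^ a * var_t ^ b = monom (monom 1 b) a"
proof -
  have s: "var_s ^ a = monom 1 a" for a
    unfolding var_s_def by (induction a) (simp_all add: monom_Suc monom_0 smult_monom one_pCons)
  have t: "var_t ^ b = [:monom 1 b:]" for b
    unfolding var_t_def by (induction b) (simp_all add: monom_Suc monom_0 smult_monom one_pCons)
  show ?thesis unfolding s t by (simp add: smult_monom mult.commute)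
qed

lemma subst2_monom: "subst2 (var_s ^ a * var_t ^ b) f g = f ^ a * g ^ b"
  unfolding var_monom subst2_def by (simp add: map_poly_monom poly_monom mult.commute)

end

theory Submission
  imports Defs
begin

text \<open>
  Expanding each factor \<open>1 + s\<close> and \<open>1 + t\<close> turns the left-hand sides into sums over permutations
  \<open>v\<close> together with a marked subset \<open>S\<close> of the descents of \<open>v\<close> and a marked subset \<open>T\<close> of the
  descents (in the strict case, of the ascents) of \<open>v\<inverse>\<close>, each weighted by \<open>s\<close> to the \<open>card S\<close> times
  \<open>t\<close> to the \<open>card T\<close>.

  A weakly increasing Cayley permutation \<open>u\<close> starts at \<open>1\<close> and climbs by steps of \<open>0\<close> or \<open>1\<close>, the
  descents being the flat steps. So \<open>u\<close> amounts to an arbitrary subset of \<open>{1..<n}\<close>, of size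
  \<open>n - max u\<close> (\<open>bij_betw_weak_descents_Inc\<close>, \<open>card_weak_descents_Inc\<close>), and both \<open>S\<close> and \<open>T\<close> may be
  replaced by such words.

  If \<open>u\<close> is the word that encodes \<open>T\<close>, then the word \<open>w = u \<circ> v\<close> is obtained from \<open>v\<close> by identifying
  the consecutive values \<open>j\<close> and \<open>j + 1\<close> for each \<open>j \<in> T\<close>. The condition on \<open>T\<close> says that equal letters
  of \<open>w\<close> come from values of \<open>v\<close> which decrease (strict case: increase) from left to right. Thus
  \<open>v\<close> is recovered from \<open>w\<close> by ranking the positions by letter and breaking ties by position:
  \<open>v\<close> is the standardization of \<open>w\<close>, and \<open>(v, T)\<close> corresponds bijectively to \<open>w\<close>
  (\<open>bij_betw_merge\<close>). The tie-breaking rule also decides whether a repeated letter of \<open>w\<close> is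
  a descent of \<open>v\<close>: the descents of \<open>v\<close> are the weak descents of \<open>w\<close> if ties are broken from right to
  left, and the strict ones if they are broken from left to right. Since \<open>max w = max u\<close>, summing over
  \<open>w\<close> and \<open>S\<close> gives the Caylerian polynomial. Both identities are instances of one argument
  whose parameter is the linear order on positions that breaks the ties.
\<close>

section \<open>Weakly increasing Cayley permutations as subsets\<close>

lemma Cay_iff: "v \<in> Cay n \<longleftrightarrow> v \<in> extensional {1..n} \<and> (\<exists>k\<le>n. v ` {1..n} = {1..k})"
proof -
  have "v \<in> {1..n} \<rightarrow> {1..n}" if "k \<le> n" "v ` {1..n} = {1..k}" for k
  proof -
    have "v ` {1..n} \<subseteq> {1..n}" using that by simp
    then show ?thesis by (simp only: image_subset_iff_funcset)
  qed
  then show ?thesis by (auto simp: Cay_def PiE_def)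
qed

lemma Inc_first:
  assumes "u \<in> Inc n" "1 \<le> n"
  shows "u 1 = 1"
proof -
  obtain k where k: "u ` {1..n} = {1..k}" using assms by (auto simp: Inc_def Cay_def)
  have "u 1 \<in> {1..k}" using k assms(2) by fastforce
  then have "1 \<in> u ` {1..n}" unfolding k by auto
  then obtain j where "j \<in> {1..n}" "u j = 1" by auto
  moreover have "u 1 \<le> u j"
    using assms \<open>j \<in> {1..n}\<close> by (auto simp: Inc_def intro: mono_onD)
  ultimately show ?thesis using \<open>u 1 \<in> {1..k}\<close> by auto
qed

text \<open>A larger jump would leave out a letter, because the word is weakly increasing.\<close>

lemma Inc_step:
  assumes "u \<in> Inc n" "1 \<le> i" "i < n"
  shows "u (Suc i) = (if i \<in> weak_descents n u then u i else Suc (u i))"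
proof -
  obtain k where k: "u ` {1..n} = {1..k}" using assms by (auto simp: Inc_def Cay_def)
  have mono: "u a \<le> u b" if "a \<in> {1..n}" "b \<in> {1..n}" "a \<le> b" for a b
    using assms(1) that by (auto simp: Inc_def intro: mono_onD)
  have "u i \<le> u (Suc i)" using mono assms by auto
  moreover have "u (Suc i) \<le> Suc (u i)"
  proof (rule ccontr)
    assume gap: "\<not> u (Suc i) \<le> Suc (u i)"
    have "u (Suc i) \<in> {1..k}" unfolding k[symmetric] using assms by auto
    then have "Suc (u i) \<in> u ` {1..n}" unfolding k using gap by auto
    then obtain j where j: "j \<in> {1..n}" "u j = Suc (u i)" by auto
    show False
    proof (cases "j \<le> i")
      case True
      then show False using mono[of j i] j assms by auto
    next
      case False
      then show False using mono[of "Suc i" j] j assms gap by auto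
    qed
  qed
  ultimately show ?thesis using assms by (auto simp: weak_descents_def)
qed

lemma card_diff_extend:
  "1 \<le> i \<Longrightarrow> card ({1..<Suc i} - T) = (if i \<in> T then card ({1..<i} - T) else Suc (card ({1..<i} - T)))"
  by (simp add: atLeastLessThanSuc insert_Diff_if)

text \<open>Each letter counts the steps taken so far, so the flat steps determine the word.\<close>

lemma Inc_eq_count:
  assumes "u \<in> Inc n" "1 \<le> i" "i \<le> n"
  shows "u i = Suc (card ({1..<i} - weak_descents n u))"
  using assms(2,3)
proof (induction i rule: dec_induct)
  case base
  then show ?case using Inc_first[OF assms(1)] by simp
next
  case (step i)
  then show ?case
    using Inc_step[OF assms(1), of i] card_diff_extend[of i "weak_descents n u"] by simp
qed

lemma weak_descents_subset: "weak_descents n v \<subseteq> {1..<n}"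
  by (auto simp: weak_descents_def)

lemma card_weak_descents_Inc:
  assumes "u \<in> Inc n"
  shows "card (weak_descents n u) = n - max_letter n u"
proof (cases "n = 0")
  case True
  then show ?thesis by (simp add: weak_descents_def)
next
  case False
  have "Max (u ` {1..n}) = u n"
    using False assms by (intro Max_eqI) (auto simp: Inc_def intro: mono_onD)
  also have "\<dots> = Suc (card ({1..<n} - weak_descents n u))"
    using Inc_eq_count[OF assms] False by simp
  also have "\<dots> = Suc (n - 1 - card (weak_descents n u))"
    using weak_descents_subset by (subst card_Diff_subset) (auto intro: finite_subset)
  finally show ?thesis
    using False card_mono[OF _ weak_descents_subset[of n u]] by (simp add: max_letter_def)
qed

text \<open>The word that is flat exactly at \<open>T\<close> leaves out no letter, as it climbs one step at a time; this
  makes it a Cayley permutation.\<close>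

lemma image_count:
  fixes n :: nat
  assumes "1 \<le> n"
  shows "(\<lambda>i. Suc (card ({1..<i} - T))) ` {1..n} = {1..Suc (card ({1..<n} - T))}"
  using assms
proof (induction n rule: dec_induct)
  case base
  then show ?case by simp
next
  case (step n)
  have "{1..Suc n} = insert (Suc n) {1..n}" by auto
  then show ?case
    using step by (simp only: image_insert card_diff_extend) auto
qed

text \<open>Weakly increasing Cayley permutations are compositions of \<open>n\<close> (the multiplicities of the
  letters), and their weak descents are the complement of the set of partial sums.\<close>

lemma bij_betw_weak_descents_Inc: "bij_betw (weak_descents n) (Inc n) (Pow {1..<n})"
  unfolding bij_betw_def
proof
  show "inj_on (weak_descents n) (Inc n)"
  proof (rule inj_onI)
    fix u u' assume u: "u \<in> Inc n" "u' \<in> Inc n" and eq: "weak_descents n u = weak_descents n u'"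
    show "u = u'"
    proof (rule extensionalityI[of _ "{1..n}"])
      show "u \<in> extensional {1..n}" "u' \<in> extensional {1..n}"
        using u by (auto simp: Inc_def Cay_def PiE_def)
      show "u i = u' i" if "i \<in> {1..n}" for i
        using that eq Inc_eq_count[OF u(1), of i] Inc_eq_count[OF u(2), of i] by simp
    qed
  qed
  show "weak_descents n ` Inc n = Pow {1..<n}"
  proof
    show "weak_descents n ` Inc n \<subseteq> Pow {1..<n}" using weak_descents_subset by auto
    show "Pow {1..<n} \<subseteq> weak_descents n ` Inc n"
    proof
      fix T assume T: "T \<in> Pow {1..<n}"
      define u where "u = (\<lambda>i\<in>{1..n}. Suc (card ({1..<i} - T)))"
      have bound: "Suc (card ({1..<i} - T)) \<le> i" if "1 \<le> i" for i
        using card_mono[of "{1..<i}" "{1..<i} - T"] that by auto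
      have im: "\<exists>k\<le>n. u ` {1..n} = {1..k}"
      proof (cases "n = 0")
        case False
        then show ?thesis
          using image_count[of n T] bound[of n] by (auto simp: u_def)
      qed auto
      have "u \<in> Cay n"
        unfolding Cay_iff using im by (simp add: u_def)
      moreover have "mono_on {1..n} u"
        by (rule mono_onI) (auto simp: u_def intro!: card_mono)
      ultimately have "u \<in> Inc n" by (simp add: Inc_def)
      moreover have "weak_descents n u = T"
        using T by (auto simp: weak_descents_def u_def card_diff_extend[simplified] split: if_splits)
      ultimately show "T \<in> weak_descents n ` Inc n" by blast
    qed
  qed
qed

lemma one_plus_power_card:
  fixes x :: "'a::comm_semiring_1"
  assumes "finite A"
  shows "(1 + x) ^ card A = (\<Sum>S\<in>Pow A. x ^ card S)"
  using prod_add[of A "\<lambda>_. x" "\<lambda>_. 1"] assms by (simp add: add.commute)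

text \<open>A power of \<open>1 + x\<close> sums over marked subsets of \<open>A\<close>; the marked subsets are recorded as weakly
  increasing words. This is used once for the descents of a permutation and once for those of its
  inverse.\<close>

lemma one_plus_power_card_Inc:
  fixes x :: "'a::comm_semiring_1"
  assumes "A \<subseteq> {1..<n}"
  shows "(1 + x) ^ card A = (\<Sum>u\<in>{u \<in> Inc n. weak_descents n u \<subseteq> A}. x ^ (n - max_letter n u))"
proof -
  have "bij_betw (weak_descents n) {u \<in> Inc n. weak_descents n u \<subseteq> A} (Pow A)"
  proof (rule bij_betw_subset[OF bij_betw_weak_descents_Inc])
    have "Pow A \<subseteq> weak_descents n ` Inc n"
      using assms bij_betw_imp_surj_on[OF bij_betw_weak_descents_Inc[of n]] by blast
    then show "weak_descents n ` {u \<in> Inc n. weak_descents n u \<subseteq> A} = Pow A" by blast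
  qed auto
  then have "(\<Sum>S\<in>Pow A. x ^ card S)
      = (\<Sum>u\<in>{u \<in> Inc n. weak_descents n u \<subseteq> A}. x ^ card (weak_descents n u))"
    by (rule sum.reindex_bij_betw[symmetric])
  moreover have "finite A" using assms by (rule finite_subset) simp
  ultimately show ?thesis
    by (simp add: one_plus_power_card card_weak_descents_Inc)
qed


section \<open>Standardization with a tie-breaking order\<close>

lemma Sym_iff: "v \<in> Sym n \<longleftrightarrow> v \<in> extensional {1..n} \<and> bij_betw v {1..n} {1..n}"
  by (auto simp: Sym_def Cay_def PiE_def bij_betw_def)

lemma perm_inv_left: "v \<in> Sym n \<Longrightarrow> i \<in> {1..n} \<Longrightarrow> perm_inv n v (v i) = i"
  unfolding Sym_iff by (auto simp: perm_inv_def bij_betw_def)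

lemma perm_inv_right: "v \<in> Sym n \<Longrightarrow> j \<in> {1..n} \<Longrightarrow> v (perm_inv n v j) = j"
  unfolding Sym_iff by (auto simp: perm_inv_def bij_betw_inv_into_right)

lemma perm_inv_mem: "v \<in> Sym n \<Longrightarrow> j \<in> {1..n} \<Longrightarrow> perm_inv n v j \<in> {1..n}"
  using inv_into_into[of j v "{1..n}"] by (auto simp: Sym_iff perm_inv_def bij_betw_def)

lemma Sym_mem: "v \<in> Sym n \<Longrightarrow> i \<in> {1..n} \<Longrightarrow> v i \<in> {1..n}"
  using bij_betw_apply[of v "{1..n}" "{1..n}" i] by (simp add: Sym_iff)

lemma Sym_eq_iff: "v \<in> Sym n \<Longrightarrow> i \<in> {1..n} \<Longrightarrow> j \<in> {1..n} \<Longrightarrow> v i = v j \<longleftrightarrow> i = j"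
  using perm_inv_left by metis

lemma finite_Inc: "finite (Inc n)"
  by (simp add: Inc_def finite_Cay)

locale tie_break =
  fixes tie :: "nat \<Rightarrow> nat \<Rightarrow> bool"  (infix \<open>\<prec>\<close> 50)
  assumes irrefl: "\<not> i \<prec> i"
    and trans: "i \<prec> j \<Longrightarrow> j \<prec> k \<Longrightarrow> i \<prec> k"
    and total: "i \<noteq> j \<Longrightarrow> i \<prec> j \<or> j \<prec> i"
begin

definition before :: "(nat \<Rightarrow> nat) \<Rightarrow> nat \<Rightarrow> nat \<Rightarrow> bool" where
  "before w i j \<longleftrightarrow> w i < w j \<or> w i = w j \<and> i \<prec> j"

definition descents :: "nat \<Rightarrow> (nat \<Rightarrow> nat) \<Rightarrow> nat set" where
  "descents n w = {i \<in> {1..<n}. before w (i + 1) i}"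

text \<open>Values \<open>j\<close> whose identification with \<open>j + 1\<close> can be undone: breaking the resulting tie puts the
  position of \<open>j\<close> back before the position of \<open>j + 1\<close>. These are the descents of the inverse
  permutation if \<open>\<prec>\<close> is \<open>>\<close>, and its ascents if \<open>\<prec>\<close> is \<open><\<close>.\<close>

definition mergeable :: "nat \<Rightarrow> (nat \<Rightarrow> nat) \<Rightarrow> nat set" where
  "mergeable n v = {j \<in> {1..<n}. perm_inv n v j \<prec> perm_inv n v (j + 1)}"

text \<open>The identified values are described by the weakly increasing word that relabels them, rather
  than by a set, so that merging becomes composition.\<close>

definition mergings :: "nat \<Rightarrow> ((nat \<Rightarrow> nat) \<times> (nat \<Rightarrow> nat)) set" where
  "mergings n = (SIGMA v:Sym n. {u \<in> Inc n. weak_descents n u \<subseteq> mergeable n v})"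

definition merge :: "nat \<Rightarrow> (nat \<Rightarrow> nat) \<times> (nat \<Rightarrow> nat) \<Rightarrow> nat \<Rightarrow> nat" where
  "merge n = (\<lambda>(v, u). compose {1..n} u v)"

definition standardize :: "nat \<Rightarrow> (nat \<Rightarrow> nat) \<Rightarrow> nat \<Rightarrow> nat" where
  "standardize n w = (\<lambda>i\<in>{1..n}. card {j \<in> {1..n}. before w j i \<or> j = i})"

lemma before_irrefl: "\<not> before w i i"
  by (simp add: before_def irrefl)

lemma before_trans: "before w i j \<Longrightarrow> before w j k \<Longrightarrow> before w i k"
  by (auto simp: before_def intro: trans)

lemma before_total: "i \<noteq> j \<Longrightarrow> before w i j \<or> before w j i"
  using total by (fastforce simp: before_def)

text \<open>Along a run of equal letters of \<open>u\<close> all steps lie in the mergeable set, so the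
  tie-breaking relations between neighbouring values chain up by transitivity.\<close>

lemma block_ordered:
  assumes "(v, u) \<in> mergings n" "1 \<le> a" "a < b" "b \<le> n" "u a = u b"
  shows "perm_inv n v a \<prec> perm_inv n v b"
  using assms(3,4,5)
proof (induction b)
  case 0
  then show ?case by simp
next
  case (Suc b)
  have mono: "u i \<le> u j" if "i \<in> {1..n}" "j \<in> {1..n}" "i \<le> j" for i j
    using assms(1) that by (auto simp: mergings_def Inc_def intro: mono_onD)
  have "u a \<le> u b" "u b \<le> u (Suc b)" using mono[of a b] mono[of b "Suc b"] Suc.prems assms(2) by auto
  then have eq: "u a = u b" "u b = u (Suc b)" using Suc.prems by auto
  then have "b \<in> weak_descents n u" using Suc.prems assms(2) by (auto simp: weak_descents_def)
  then have last: "perm_inv n v b \<prec> perm_inv n v (Suc b)"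
    using assms(1) by (auto simp: mergings_def mergeable_def)
  show ?case
  proof (cases "a = b")
    case False
    then show ?thesis using Suc eq last by (auto intro: trans)
  qed (use last in simp)
qed

text \<open>Hence the positions of \<open>w = u \<circ> v\<close>, sorted by letter with ties broken by \<open>\<prec>\<close>, appear in the
  order of their values under \<open>v\<close>.\<close>

lemma less_iff_before_merge:
  assumes "(v, u) \<in> mergings n" "i \<in> {1..n}" "j \<in> {1..n}"
  shows "v i < v j \<longleftrightarrow> before (merge n (v, u)) i j"
proof -
  have v: "v \<in> Sym n" and mono: "mono_on {1..n} u"
    using assms(1) by (auto simp: mergings_def Inc_def)
  have imp: "before (merge n (v, u)) i j"
    if ij: "i \<in> {1..n}" "j \<in> {1..n}" and less: "v i < v j" for i j
  proof -
    have mem: "v i \<in> {1..n}" "v j \<in> {1..n}" using Sym_mem[OF v] ij by auto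
    have "u (v i) \<le> u (v j)" using mono mem less by (auto intro: mono_onD)
    moreover have "i \<prec> j" if "u (v i) = u (v j)"
      using block_ordered[OF assms(1) _ less _ that] mem
      by (simp add: perm_inv_left[OF v ij(1)] perm_inv_left[OF v ij(2)])
    ultimately show ?thesis using ij by (auto simp: before_def merge_def compose_def)
  qed
  show ?thesis
  proof
    assume b: "before (merge n (v, u)) i j"
    then have "i \<noteq> j" using before_irrefl by auto
    then have "v i \<noteq> v j" using Sym_eq_iff[OF v assms(2,3)] by simp
    moreover have "\<not> v j < v i"
      using imp[OF assms(3,2)] before_trans[OF b] before_irrefl by blast
    ultimately show "v i < v j" by simp
  qed (rule imp[OF assms(2,3)])
qed

lemma standardize_less_iff:
  assumes "i \<in> {1..n}" "j \<in> {1..n}"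
  shows "standardize n w i < standardize n w j \<longleftrightarrow> before w i j"
proof -
  have imp: "standardize n w i < standardize n w j"
    if "i \<in> {1..n}" "j \<in> {1..n}" "before w i j" for i j
  proof -
    have "{k \<in> {1..n}. before w k i \<or> k = i} \<subset> {k \<in> {1..n}. before w k j \<or> k = j}"
      using that before_trans before_irrefl by blast
    then have "card {k \<in> {1..n}. before w k i \<or> k = i} < card {k \<in> {1..n}. before w k j \<or> k = j}"
      by (rule psubset_card_mono[rotated]) simp
    then show ?thesis using that by (simp add: standardize_def)
  qed
  show ?thesis
    using imp[OF assms] imp[OF assms(2,1)] before_total[of i j w] by fastforce
qed

lemma standardize_Sym: "standardize n w \<in> Sym n"
proof -
  have inj: "inj_on (standardize n w) {1..n}"
  proof (rule inj_onI, rule ccontr)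
    fix i j assume "i \<in> {1..n}" "j \<in> {1..n}" "standardize n w i = standardize n w j" "i \<noteq> j"
    then show False
      using before_total[of i j w] standardize_less_iff[of i n j w] standardize_less_iff[of j n i w]
      by simp
  qed
  have "standardize n w i \<in> {1..n}" if "i \<in> {1..n}" for i
  proof -
    have "card {j \<in> {1..n}. before w j i \<or> j = i} \<le> card {1..n}" by (rule card_mono) auto
    moreover have "card {j \<in> {1..n}. before w j i \<or> j = i} > 0"
      using that by (subst card_gt_0_iff) auto
    ultimately show ?thesis using that by (simp add: standardize_def)
  qed
  then have "standardize n w ` {1..n} = {1..n}"
    using inj by (intro endo_inj_surj) auto
  then show ?thesis using inj by (auto simp: Sym_iff bij_betw_def standardize_def)
qed

text \<open>A permutation is determined by the order it induces on positions, since \<open>v i\<close> is the number of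
  positions whose value is at most \<open>v i\<close>.\<close>

lemma standardize_merge:
  assumes "(v, u) \<in> mergings n"
  shows "standardize n (merge n (v, u)) = v"
proof (rule extensionalityI[of _ "{1..n}"])
  have v: "v \<in> Sym n" using assms by (auto simp: mergings_def)
  then have bij: "bij_betw v {1..n} {1..n}" by (simp add: Sym_iff)
  show "v \<in> extensional {1..n}" using v by (simp add: Sym_iff)
  show "standardize n (merge n (v, u)) \<in> extensional {1..n}" by (simp add: standardize_def)
  fix i assume i: "i \<in> {1..n}"
  have "{j \<in> {1..n}. before (merge n (v, u)) j i \<or> j = i} = {j \<in> {1..n}. v j \<le> v i}"
    using less_iff_before_merge[OF assms _ i] Sym_eq_iff[OF v _ i] by (auto simp: le_less)
  moreover have "v ` {j \<in> {1..n}. v j \<le> v i} = {1..v i}"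
  proof
    show "v ` {j \<in> {1..n}. v j \<le> v i} \<subseteq> {1..v i}" using Sym_mem[OF v] by fastforce
    have "{1..v i} \<subseteq> v ` {1..n}" using bij Sym_mem[OF v i] by (auto simp: bij_betw_def)
    then show "{1..v i} \<subseteq> v ` {j \<in> {1..n}. v j \<le> v i}" by fastforce
  qed
  moreover have "inj_on v {j \<in> {1..n}. v j \<le> v i}"
    by (rule inj_on_subset[OF bij_betw_imp_inj_on[OF bij]]) auto
  ultimately show "standardize n (merge n (v, u)) i = v i"
    using i card_image[of v "{j \<in> {1..n}. v j \<le> v i}"] by (simp add: standardize_def)
qed

lemma merge_image:
  assumes "(v, u) \<in> mergings n"
  shows "merge n (v, u) ` {1..n} = u ` {1..n}"
proof -
  have "v ` {1..n} = {1..n}" using assms by (simp add: mergings_def Sym_iff bij_betw_def)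
  then have "u ` {1..n} = (u \<circ> v) ` {1..n}" by (simp only: image_comp[symmetric])
  also have "\<dots> = merge n (v, u) ` {1..n}"
    by (rule image_cong) (simp_all add: merge_def compose_eq)
  finally show ?thesis by (rule sym)
qed

lemma max_letter_merge:
  "(v, u) \<in> mergings n \<Longrightarrow> max_letter n (merge n (v, u)) = max_letter n u"
  using merge_image by (simp add: max_letter_def)

text \<open>Breaking ties undoes the merging, so neighbouring letters compare alike before and after it.\<close>

lemma descents_merge:
  assumes "(v, u) \<in> mergings n"
  shows "descents n (merge n (v, u)) = weak_descents n v"
proof -
  have v: "v \<in> Sym n" using assms by (simp add: mergings_def)
  have "before (merge n (v, u)) (i + 1) i \<longleftrightarrow> v (i + 1) \<le> v i" if "i \<in> {1..<n}" for i
    using that less_iff_before_merge[OF assms, of "i + 1" i] Sym_eq_iff[OF v, of "i + 1" i]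
    by (cases "v (i + 1) < v i") auto
  then show ?thesis by (auto simp: descents_def weak_descents_def)
qed

text \<open>Standardizing \<open>w = u \<circ> v\<close> gives back \<open>v\<close>, and then \<open>u = w \<circ> v\<inverse>\<close>. The same formulas produce a
  preimage of any Cayley permutation: reading the letters of \<open>w\<close> in the order of the ranks
  gives a weakly increasing word, and positions of consecutive rank with equal letters are
  ordered by \<open>\<prec>\<close>.\<close>

lemma bij_betw_merge: "bij_betw (merge n) (mergings n) (Cay n)"
  unfolding bij_betw_def
proof
  show "inj_on (merge n) (mergings n)"
  proof (rule inj_onI, clarify)
    fix v u v' u'
    assume m: "(v, u) \<in> mergings n" "(v', u') \<in> mergings n"
      and eq: "merge n (v, u) = merge n (v', u')"
    have vv: "v = v'" using standardize_merge[OF m(1)] standardize_merge[OF m(2)] eq by simp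
    have "u = u'"
    proof (rule extensionalityI[of _ "{1..n}"])
      show "u \<in> extensional {1..n}" "u' \<in> extensional {1..n}"
        using m by (auto simp: mergings_def Inc_def Cay_def PiE_def)
      have v: "v \<in> Sym n" using m by (simp add: mergings_def)
      show "u j = u' j" if "j \<in> {1..n}" for j
        using fun_cong[OF eq, of "perm_inv n v j"] perm_inv_mem[OF v that] perm_inv_right[OF v that] vv
        by (simp add: merge_def compose_def)
    qed
    with vv show "v = v' \<and> u = u'" by simp
  qed
  show "merge n ` mergings n = Cay n"
  proof
    show "merge n ` mergings n \<subseteq> Cay n"
    proof clarify
      fix v u assume m: "(v, u) \<in> mergings n"
      then have u: "u \<in> Cay n" by (auto simp: mergings_def Inc_def)
      then show "merge n (v, u) \<in> Cay n"
        using merge_image[OF m] by (simp add: Cay_iff merge_def compose_extensional)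
    qed
    show "Cay n \<subseteq> merge n ` mergings n"
    proof
      fix w assume w: "w \<in> Cay n"
      define v where "v = standardize n w"
      define u where "u = (\<lambda>j\<in>{1..n}. w (perm_inv n v j))"
      have v: "v \<in> Sym n" by (simp add: v_def standardize_Sym)
      have ord: "before w (perm_inv n v a) (perm_inv n v b)"
        if "a \<in> {1..n}" "b \<in> {1..n}" "a < b" for a b
        using standardize_less_iff[of "perm_inv n v a" n "perm_inv n v b" w]
          perm_inv_mem[OF v] perm_inv_right[OF v] that by (simp add: v_def[symmetric])
      have wuv: "w i = u (v i)" if "i \<in> {1..n}" for i
        using that Sym_mem[OF v that] perm_inv_left[OF v that] by (simp add: u_def)
      have "u ` {1..n} = u ` v ` {1..n}" using v by (simp add: Sym_iff bij_betw_def)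
      also have "\<dots> = w ` {1..n}" using wuv by (auto simp: image_iff)
      finally have im: "u ` {1..n} = w ` {1..n}" .
      have "u \<in> Cay n" using im w by (simp add: Cay_iff u_def)
      moreover have "mono_on {1..n} u"
      proof (rule mono_onI)
        fix a b assume "a \<in> {1..n}" "b \<in> {1..n}" "a \<le> b"
        then show "u a \<le> u b" using ord[of a b] by (cases "a = b") (auto simp: u_def before_def)
      qed
      moreover have "weak_descents n u \<subseteq> mergeable n v"
      proof
        fix j assume j: "j \<in> weak_descents n u"
        then show "j \<in> mergeable n v"
          using ord[of j "j + 1"] by (auto simp: weak_descents_def mergeable_def u_def before_def)
      qed
      ultimately have "(v, u) \<in> mergings n" using v by (simp add: mergings_def Inc_def)
      moreover have "merge n (v, u) = w"
        by (rule extensionalityI[of _ "{1..n}"])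
          (use w wuv in \<open>auto simp: merge_def Cay_def PiE_def compose_eq\<close>)
      ultimately show "w \<in> merge n ` mergings n" by (metis imageI)
    qed
  qed
qed


section \<open>The generating function identity\<close>

text \<open>The factor \<open>(1 + y) ^ card (mergeable n v)\<close> expands over the ways of merging values of \<open>v\<close>, and
  merging turns this into a sum over all Cayley permutations \<open>w\<close>. The other factor depends
  on \<open>v\<close> only through its descents, hence is a function of \<open>descents n w\<close> and can be expanded
  after the change of variables.\<close>

theorem sum_Sym_eq_sum_Inc_Cay:
  fixes x y :: "'a::comm_semiring_1"
  shows "(\<Sum>v\<in>Sym n. (1 + x) ^ des n v * (1 + y) ^ card (mergeable n v))
    = (\<Sum>(u, w)\<in>{(u, w) \<in> Inc n \<times> Cay n. weak_descents n u \<subseteq> descents n w}.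
        x ^ (n - max_letter n u) * y ^ (n - max_letter n w))"
proof -
  define g where "g A = (\<Sum>u\<in>{u \<in> Inc n. weak_descents n u \<subseteq> A}. x ^ (n - max_letter n u))" for A
  have "(\<Sum>v\<in>Sym n. (1 + x) ^ des n v * (1 + y) ^ card (mergeable n v))
      = (\<Sum>v\<in>Sym n. \<Sum>u\<in>{u \<in> Inc n. weak_descents n u \<subseteq> mergeable n v}.
          g (weak_descents n v) * y ^ (n - max_letter n u))"
  proof (rule sum.cong)
    fix v
    have mergeable: "mergeable n v \<subseteq> {1..<n}" by (auto simp: mergeable_def)
    show "(1 + x) ^ des n v * (1 + y) ^ card (mergeable n v)
      = (\<Sum>u\<in>{u \<in> Inc n. weak_descents n u \<subseteq> mergeable n v}.
          g (weak_descents n v) * y ^ (n - max_letter n u))"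
      unfolding des_def g_def
        one_plus_power_card_Inc[OF weak_descents_subset] one_plus_power_card_Inc[OF mergeable]
      by (rule sum_distrib_left)
  qed simp
  also have "\<dots> = (\<Sum>(v, u)\<in>mergings n. g (weak_descents n v) * y ^ (n - max_letter n u))"
    unfolding mergings_def by (rule sum.Sigma) (auto simp: finite_Sym finite_Inc)
  also have "\<dots> = (\<Sum>p\<in>mergings n. g (descents n (merge n p)) * y ^ (n - max_letter n (merge n p)))"
    by (rule sum.cong) (auto simp: descents_merge max_letter_merge)
  also have "\<dots> = (\<Sum>w\<in>Cay n. g (descents n w) * y ^ (n - max_letter n w))"
    by (rule sum.reindex_bij_betw[OF bij_betw_merge])
  also have "\<dots> = (\<Sum>w\<in>Cay n. \<Sum>u\<in>{u \<in> Inc n. weak_descents n u \<subseteq> descents n w}.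
      x ^ (n - max_letter n u) * y ^ (n - max_letter n w))"
    by (simp add: g_def sum_distrib_right)
  also have "\<dots> = (\<Sum>(w, u)\<in>(SIGMA w:Cay n. {u \<in> Inc n. weak_descents n u \<subseteq> descents n w}).
      x ^ (n - max_letter n u) * y ^ (n - max_letter n w))"
    by (rule sum.Sigma) (auto simp: finite_Cay finite_Inc)
  also have "\<dots> = (\<Sum>(u, w)\<in>{(u, w) \<in> Inc n \<times> Cay n. weak_descents n u \<subseteq> descents n w}.
        x ^ (n - max_letter n u) * y ^ (n - max_letter n w))"
    by (rule sum.reindex_bij_witness[of _ prod.swap prod.swap]) auto
  finally show ?thesis .
qed

end

text \<open>With ties broken from right to left a repeated letter counts as a descent, which gives the weak
  statistics; breaking them from left to right gives the strict ones.\<close>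

interpretation right_to_left: tie_break "(>)"
  by unfold_locales auto

interpretation left_to_right: tie_break "(<)"
  by unfold_locales auto

text \<open>An inverse permutation has no repeated letters, so its weak and strict descents agree, and so do
  its weak and strict ascents.\<close>

lemma perm_inv_Suc_neq:
  assumes "v \<in> Sym n" "j \<in> {1..<n}"
  shows "perm_inv n v j \<noteq> perm_inv n v (j + 1)"
  using perm_inv_right[OF assms(1), of j] perm_inv_right[OF assms(1), of "j + 1"] assms(2) by auto

lemma card_mergeable_right_to_left:
  assumes "v \<in> Sym n"
  shows "card (right_to_left.mergeable n v) = des n (perm_inv n v)"
proof -
  have "right_to_left.mergeable n v = weak_descents n (perm_inv n v)"
    using perm_inv_Suc_neq[OF assms]
    by (fastforce simp: right_to_left.mergeable_def weak_descents_def le_less)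
  then show ?thesis by (simp add: des_def)
qed

lemma card_mergeable_left_to_right:
  assumes "v \<in> Sym n"
  shows "card (left_to_right.mergeable n v) = asc n (perm_inv n v)"
proof -
  have "left_to_right.mergeable n v = {j \<in> {1..<n}. perm_inv n v j \<le> perm_inv n v (j + 1)}"
    using perm_inv_Suc_neq[OF assms]
    by (fastforce simp: left_to_right.mergeable_def le_less)
  then show ?thesis by (simp add: asc_def)
qed

lemma descents_right_to_left: "right_to_left.descents n w = weak_descents n w"
  by (auto simp: right_to_left.descents_def right_to_left.before_def weak_descents_def)

lemma descents_left_to_right: "left_to_right.descents n w = strict_descents n w"
  by (auto simp: left_to_right.descents_def left_to_right.before_def strict_descents_def)

theorem theorem6p4:
  fixes n :: nat
  shows "subst2 (two_sided_Eulerian n) (1 + var_s) (1 + var_t) = two_sided_Caylerian n \<and>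
         subst2 (two_sided_Eulerian_strict n) (1 + var_s) (1 + var_t) = two_sided_Caylerian_strict n"
proof
  show "subst2 (two_sided_Eulerian n) (1 + var_s) (1 + var_t) = two_sided_Caylerian n"
    using right_to_left.sum_Sym_eq_sum_Inc_Cay[of var_s n var_t]
    by (simp add: two_sided_Eulerian_def two_sided_Caylerian_def subst2_sum subst2_monom Bur_def
        card_mergeable_right_to_left descents_right_to_left)
  show "subst2 (two_sided_Eulerian_strict n) (1 + var_s) (1 + var_t) = two_sided_Caylerian_strict n"
    using left_to_right.sum_Sym_eq_sum_Inc_Cay[of var_s n var_t]
    by (simp add: two_sided_Eulerian_strict_def two_sided_Caylerian_strict_def subst2_sum
        subst2_monom Bur01_def card_mergeable_left_to_right descents_left_to_right)
qed

end
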